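(* Let $w$ be an edge path in an associahedron, and let $T$ be the tree whose internal vertices are the vertices of $\Sigma(w)$ (that is, the smallest finite binary tree having all endpoints of edges of $\Sigma(w)$ among its internal vertices). If the pair $(T,Tw)$ is prime, then $\Sigma(w)$, as a graph whose vertex set is the set of internal vertices of $T$, is connected.
   Context: **Trees.** $\mathcal T$ is the infinite binary tree whose vertices are a root $*$ and all finite words over $\{0,1\}$ (including the empty word $\emptyset$). The only child of $*$ is $\emptyset$; the word $u$ has left child $u0$ and right child $u1$. A finite binary tree is a finite subtree of $\mathcal T$ containing $*$ and $\emptyset$, closed under taking prefixes, in which $u0$ is a vertex iff $u1$ is. Leaves are the vertices without children, numbered from left to right; internal vertices are the words in the tree that are not leaves. **Rotations.** For $u\in\{0,1\}^*$, the rotation $\lceil u\rfloor$ is the permutation of the vertices of $\mathcal T$ (acting on the right) given by $u00w\mapsto u0w$, $u01w\mapsto u10w$, $u1w\mapsto u11w$ for all $w\in\{0,1\}^*$, $u0\mapsto u$, $u\mapsto u1$, and fixing every other vertex. The symbol $\overline u$ is formal and $\lceil\overline u\rfloor=\lceil u\rfloor^{-1}$. The pivot vertices of $\lceil u\rfloor$ are $u$ and $u0$; those of $\lceil\overline u\rfloor$ are $u$ and $u1$. If both pivot vertices of a rotation $\lceil v\rfloor$ are internal vertices of a finite binary tree $T$, then $\lceil v\rfloor$ applies to $T$, and $T\lceil v\rfloor$ is the finite binary tree whose vertex set is the image of that of $T$. **Associahedron.** The vertices of the $d$-dimensional associahedron $A_d$ are the finite binary trees with $d+2$ leaves; edges correspond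 to rotations. An edge path starting at a tree $D$ is a word $w=\lceil v_1\rfloor\cdots\lceil v_k\rfloor$ (each $v_i$ of the form $u$ or $\overline u$) such that each $\lceil v_i\rfloor$ applies to $D\lceil v_1\rfloor\cdots\lceil v_{i-1}\rfloor$; its endpoint is $Dw$. For $T$ as in the claim, the word $w$ also gives an edge path starting at $T$, ending at $Tw$. **The signed graph $\Sigma(w)$ (sign structure).** Put $p_0=\mathrm{id}$ and $p_i=\lceil v_1\rfloor\cdots\lceil v_i\rfloor$ (permutations act on the right, composed left to right). $\Sigma_0$ has no edges. $\Sigma_i$ is obtained from $\Sigma_{i-1}$ by adding one edge $e_i$ (parallel edges allowed) joining $s=(x)p_{i-1}^{-1}$ and $t=(y)p_{i-1}^{-1}$, where $x,y$ are the pivot vertices of $\lceil v_i\rfloor$; $e_i$ is positive iff the sum of the degrees of $s$ and $t$ in $\Sigma_{i-1}$ is even. $\Sigma(w)$ has the edges of $\Sigma_k$, and its vertex set is the set of internal vertices of the smallest finite binary tree whose internal vertices include all endpoints of these edges. **Prime pairs.** A finite binary tree with $n\ge 2$ leaves is dual to a triangulation (with no extra vertices) of an $(n+1)$-gon, the boundary edges corresponding in cyclic order to the root and the leaves in left-right order. A pair $(D,R)$ of trees with the same number $n\geq 2$ of leaves is prime if the graph on $S^2$ obtained by gluing the two dual triangulated polygons along their common boundary has no parallel edges, i.e. the two triangulations have no common diagonal. Equivalently: there are no internal vertices $a\neq\emptyset$ of $D$ and $b\ne\emptyset$ of $R$ such that the set of leaf numbers of leaves of $D$ below $a$ equals the set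 of leaf numbers of leaves of $R$ below $b$. *)

theory Defs
  imports "Graph_Theory.Digraph_Component" "HOL-Library.Sublist"
begin

section \<open>Finite binary trees\<close>

text \<open>Words over \<open>{0,1}\<close> are Boolean lists, with \<open>False\<close> for \<open>0\<close> (left) and \<open>True\<close> for
  \<open>1\<close> (right).\<close>

type_synonym word = "bool list"

datatype vertex = Root | Word word

fun children :: "vertex \<Rightarrow> vertex set" where
  "children Root = {Word []}"
| "children (Word u) = {Word (u @ [False]), Word (u @ [True])}"

definition binary_tree :: "vertex set \<Rightarrow> bool" where
  "binary_tree T \<longleftrightarrow> finite T \<and> Root \<in> T \<and> Word [] \<in> T
     \<and> (\<forall>u v. Word v \<in> T \<longrightarrow> prefix u v \<longrightarrow> Word u \<in> T)
     \<and> (\<forall>u. Word (u @ [False]) \<in> T \<longleftrightarrow> Word (u @ [True]) \<in> T)"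

definition leaves :: "vertex set \<Rightarrow> vertex set" where
  "leaves T = {v \<in> T. children v \<inter> T = {}}"

text \<open>The root is neither a leaf nor an internal vertex.\<close>

definition internal :: "vertex set \<Rightarrow> vertex set" where
  "internal T = {v \<in> T. v \<noteq> Root \<and> v \<notin> leaves T}"

definition smallest_tree :: "vertex set \<Rightarrow> vertex set" where
  "smallest_tree S = (LEAST T. binary_tree T \<and> S \<subseteq> internal T)"


section \<open>Rotations\<close>

text \<open>The rotation at the empty word, on words; the rotation at \<open>u\<close> applies it to what follows
  the prefix \<open>u\<close>.\<close>

fun rot_suffix :: "word \<Rightarrow> word" where
  "rot_suffix (False # False # w) = False # w"
| "rot_suffix (False # True # w) = True # False # w"
| "rot_suffix (True # w) = True # True # w"
| "rot_suffix [False] = []"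
| "rot_suffix [] = [True]"

fun rotate_at :: "word \<Rightarrow> vertex \<Rightarrow> vertex" where
  "rotate_at u Root = Root"
| "rotate_at u (Word v) =
     (if prefix u v then Word (u @ rot_suffix (drop (length u) v)) else Word v)"

text \<open>The formal symbols \<open>u\<close> and \<open>u\<close> overlined.\<close>

datatype rot_symbol = Pos word | Neg word

fun rotation :: "rot_symbol \<Rightarrow> vertex \<Rightarrow> vertex" where
  "rotation (Pos u) = rotate_at u"
| "rotation (Neg u) = inv (rotate_at u)"

fun pivots :: "rot_symbol \<Rightarrow> vertex \<times> vertex" where
  "pivots (Pos u) = (Word u, Word (u @ [False]))"
| "pivots (Neg u) = (Word u, Word (u @ [True]))"

definition applies_to :: "rot_symbol \<Rightarrow> vertex set \<Rightarrow> bool" where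
  "applies_to v T \<longleftrightarrow> binary_tree T \<and> fst (pivots v) \<in> internal T \<and> snd (pivots v) \<in> internal T"

text \<open>The permutation given by a word in the rotations. Permutations act on the right, so the
  first letter is applied first.\<close>

primrec word_perm :: "rot_symbol list \<Rightarrow> vertex \<Rightarrow> vertex" where
  "word_perm [] = id"
| "word_perm (v # w) = word_perm w \<circ> rotation v"

definition act :: "vertex set \<Rightarrow> rot_symbol list \<Rightarrow> vertex set" where
  "act T w = word_perm w ` T"


section \<open>Edge paths in associahedra\<close>

definition associahedron_vertices :: "nat \<Rightarrow> vertex set set" where
  "associahedron_vertices d = {D. binary_tree D \<and> card (leaves D) = d + 2}"

definition edge_path :: "nat \<Rightarrow> vertex set \<Rightarrow> rot_symbol list \<Rightarrow> bool" where
  "edge_path d D w \<longleftrightarrow> D \<in> associahedron_vertices d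
     \<and> (\<forall>i<length w. applies_to (w ! i) (act D (take i w)))"


section \<open>The signed graph of an edge path\<close>

text \<open>A signed multigraph is given by the list of its edges. The two ends of an edge are unordered:
  the order in which they are listed is never used.\<close>

datatype signed_edge = Signed_Edge (end1: vertex) (end2: vertex) (positive: bool)

definition degree :: "signed_edge list \<Rightarrow> vertex \<Rightarrow> nat" where
  "degree E s = length (filter (\<lambda>e. end1 e = s) E) + length (filter (\<lambda>e. end2 e = s) E)"

primrec Sigma_upto :: "rot_symbol list \<Rightarrow> nat \<Rightarrow> signed_edge list" where
  "Sigma_upto w 0 = []"
| "Sigma_upto w (Suc i) =
     (let E = Sigma_upto w i;
          s = inv (word_perm (take i w)) (fst (pivots (w ! i)));
          t = inv (word_perm (take i w)) (snd (pivots (w ! i)))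
      in E @ [Signed_Edge s t (even (degree E s + degree E t))])"

definition Sigma_edges :: "rot_symbol list \<Rightarrow> signed_edge list" where
  "Sigma_edges w = Sigma_upto w (length w)"

definition Sigma_tree :: "rot_symbol list \<Rightarrow> vertex set" where
  "Sigma_tree w = smallest_tree (\<Union>e\<in>set (Sigma_edges w). {end1 e, end2 e})"

text \<open>The underlying unsigned multigraph, whose edges are named by their positions in the edge
  list. \<^const>\<open>connected\<close> refers to the symmetrised arc relation, so the orientation from the
  first to the second listed end does not matter.\<close>

definition Sigma_graph :: "rot_symbol list \<Rightarrow> (vertex, nat) pre_digraph" where
  "Sigma_graph w =
     \<lparr>verts = internal (Sigma_tree w),
      arcs = {..<length (Sigma_edges w)},
      tail = (\<lambda>i. end1 (Sigma_edges w ! i)),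
      head = (\<lambda>i. end2 (Sigma_edges w ! i))\<rparr>"


section \<open>Prime pairs of trees\<close>

definition left_of :: "word \<Rightarrow> word \<Rightarrow> bool" where
  "left_of a b \<longleftrightarrow> (\<exists>p. prefix (p @ [False]) a \<and> prefix (p @ [True]) b)"

text \<open>The polygon of a tree with \<open>n\<close> leaves has corners \<open>0, \<dots>, n\<close>. With leaves numbered from
  \<open>0\<close> to \<open>n - 1\<close>, the side of leaf \<open>i\<close> joins the corners \<open>i\<close> and \<open>i + 1\<close>; the side of the root
  joins \<open>n\<close> and \<open>0\<close>. The edge of the tree above the word \<open>a\<close> is dual to the chord which separates
  the sides of the leaves below \<open>a\<close> from all other sides. It is a diagonal iff \<open>a\<close> is internal
  and not the empty word.\<close>

definition chord :: "vertex set \<Rightarrow> word \<Rightarrow> nat set" where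
  "chord T a =
     (let l = card {b. Word b \<in> leaves T \<and> left_of b a};
          m = card {b. Word b \<in> leaves T \<and> prefix a b}
      in {l, l + m})"

text \<open>The edges of the graph on the sphere: the sides are common to the two polygons, and the
  diagonals of the two triangulations stay separate edges.\<close>

datatype glued_edge = Side nat | Diagonal1 word | Diagonal2 word

definition glued_edges :: "vertex set \<Rightarrow> vertex set \<Rightarrow> glued_edge set" where
  "glued_edges D R =
     Side ` {..card (leaves D)}
     \<union> Diagonal1 ` {a. a \<noteq> [] \<and> Word a \<in> internal D}
     \<union> Diagonal2 ` {b. b \<noteq> [] \<and> Word b \<in> internal R}"

fun glued_ends :: "vertex set \<Rightarrow> vertex set \<Rightarrow> glued_edge \<Rightarrow> nat set" where
  "glued_ends D R (Side i) = {i, Suc i mod Suc (card (leaves D))}"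
| "glued_ends D R (Diagonal1 a) = chord D a"
| "glued_ends D R (Diagonal2 b) = chord R b"

text \<open>The graph has no parallel edges iff its edges are determined by their sets of ends.\<close>

definition prime_pair :: "vertex set \<Rightarrow> vertex set \<Rightarrow> bool" where
  "prime_pair D R \<longleftrightarrow> binary_tree D \<and> binary_tree R
     \<and> card (leaves D) = card (leaves R) \<and> card (leaves D) \<ge> 2
     \<and> inj_on (glued_ends D R) (glued_edges D R)"


section \<open>Well-definedness\<close>

fun unrot_suffix :: "word \<Rightarrow> word" where
  "unrot_suffix (True # True # w) = True # w"
| "unrot_suffix (True # False # w) = False # True # w"
| "unrot_suffix (False # w) = False # False # w"
| "unrot_suffix [True] = []"
| "unrot_suffix [] = [False]"

lemma unrot_rot_suffix: "unrot_suffix (rot_suffix w) = w"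
  by (cases w rule: rot_suffix.cases) auto

lemma rot_unrot_suffix: "rot_suffix (unrot_suffix w) = w"
  by (cases w rule: unrot_suffix.cases) auto

fun unrotate_at :: "word \<Rightarrow> vertex \<Rightarrow> vertex" where
  "unrotate_at u Root = Root"
| "unrotate_at u (Word v) =
     (if prefix u v then Word (u @ unrot_suffix (drop (length u) v)) else Word v)"

lemma unrotate_rotate_at: "unrotate_at u (rotate_at u x) = x"
  by (cases x) (auto simp: unrot_rot_suffix prefix_def)

lemma rotate_unrotate_at: "rotate_at u (unrotate_at u x) = x"
  by (cases x) (auto simp: rot_unrot_suffix prefix_def)

lemma bij_rotate_at: "bij (rotate_at u)"
  by (rule bijI') (metis unrotate_rotate_at, metis rotate_unrotate_at)

lemma inv_rotate_at: "inv (rotate_at u) = unrotate_at u"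
  by (rule inv_equality) (auto simp: unrotate_rotate_at rotate_unrotate_at)

lemma bij_rotation: "bij (rotation v)"
  by (cases v) (auto simp: bij_rotate_at bij_imp_bij_inv)

lemma rotation_Root [simp]: "rotation v Root = Root"
  by (cases v) (auto simp: inv_rotate_at)

lemma bij_word_perm: "bij (word_perm w)"
proof (induction w)
  case (Cons v w)
  then show ?case
    unfolding word_perm.simps by (rule bij_comp[OF bij_rotation])
qed (simp only: word_perm.simps bij_id)

lemma word_perm_Root [simp]: "word_perm w Root = Root"
  by (induction w) auto

lemma smallest_tree:
  assumes "finite S" "Root \<notin> S"
  shows "binary_tree (smallest_tree S)" "S \<subseteq> internal (smallest_tree S)"
    "\<And>T. binary_tree T \<Longrightarrow> S \<subseteq> internal T \<Longrightarrow> smallest_tree S \<subseteq> T"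
proof -
  define I where "I = {u. \<exists>v. Word v \<in> S \<and> prefix u v}"
  define M where "M = {Root, Word []} \<union> (\<lambda>(u, c). Word (u @ [c])) ` (I \<times> UNIV)"
  have "I = (\<Union>x\<in>S. case x of Root \<Rightarrow> {} | Word v \<Rightarrow> set (prefixes v))"
    by (auto simp: I_def split: vertex.splits)
  then have "finite I"
    using assms(1) by (auto split: vertex.splits)
  have I_closed: "u \<in> I" if "v \<in> I" "prefix u v" for u v
    using that unfolding I_def by (blast intro: prefix_order.trans)
  have M_iff: "Word v \<in> M \<longleftrightarrow> v = [] \<or> butlast v \<in> I" for v
    by (cases v rule: rev_cases) (auto simp: M_def image_iff)
  have tree: "binary_tree M"
    unfolding binary_tree_def
  proof (intro conjI allI impI)
    show "finite M"
      using \<open>finite I\<close> by (simp add: M_def)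
    show "Root \<in> M" "Word [] \<in> M"
      by (auto simp: M_def)
    show "Word (u @ [False]) \<in> M \<longleftrightarrow> Word (u @ [True]) \<in> M" for u
      by (simp add: M_iff)
    show "Word u \<in> M" if v: "Word v \<in> M" "prefix u v" for u v
    proof (cases "u = [] \<or> u = v")
      case True
      then show ?thesis using v by (auto simp: M_iff)
    next
      case False
      then have "v \<noteq> []" "butlast v \<in> I"
        using v by (auto simp: M_iff)
      moreover obtain ys where "v = u @ ys" "ys \<noteq> []"
        using v(2) False by (auto simp: prefix_def)
      then have "prefix u (butlast v)"
        by (simp add: butlast_append)
      then have "prefix (butlast u) (butlast v)"
        by (rule prefix_order.trans[OF prefixeq_butlast])
      ultimately show ?thesis
        using I_closed by (auto simp: M_iff)
    qed
  qed
  have sub: "S \<subseteq> internal M"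
  proof
    fix x assume "x \<in> S"
    then obtain v where x: "x = Word v" "v \<in> I"
      using assms(2) by (cases x) (auto simp: I_def)
    moreover from x have "butlast v \<in> I"
      using I_closed prefixeq_butlast by blast
    ultimately show "x \<in> internal M"
      by (auto simp: internal_def leaves_def M_iff)
  qed
  have min: "M \<subseteq> T" if T: "binary_tree T" "S \<subseteq> internal T" for T
  proof
    fix x assume "x \<in> M"
    then consider "x = Root \<or> x = Word []"
      | u c v where "x = Word (u @ [c])" "Word v \<in> S" "prefix u v"
      by (auto simp: M_def I_def)
    then show "x \<in> T"
    proof cases
      case 1
      then show ?thesis using T by (auto simp: binary_tree_def)
    next
      case (2 u c v)
      then have "Word v \<in> internal T" using T by auto
      then obtain b where "Word (v @ [b]) \<in> T"
        by (auto simp: internal_def leaves_def)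
      moreover obtain b' where "prefix (u @ [b']) (v @ [b])"
      proof (cases "u = v")
        case False
        then obtain b' ys where "v = u @ b' # ys"
          using 2(3) by (metis append_Nil2 neq_Nil_conv prefixE)
        then have "prefix (u @ [b']) v"
          by (auto simp: prefix_def)
        then show ?thesis using that by auto
      qed (use that in auto)
      ultimately have "Word (u @ [b']) \<in> T"
        using T unfolding binary_tree_def by blast
      then show ?thesis
        using T 2(1) unfolding binary_tree_def by (cases b'; cases c) auto
    qed
  qed
  have "smallest_tree S = M"
    unfolding smallest_tree_def by (rule Least_equality) (use tree sub min in auto)
  then show "binary_tree (smallest_tree S)" "S \<subseteq> internal (smallest_tree S)"
    "\<And>T. binary_tree T \<Longrightarrow> S \<subseteq> internal T \<Longrightarrow> smallest_tree S \<subseteq> T"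
    using tree sub min by auto
qed

lemma Root_notin_Sigma_upto: "e \<in> set (Sigma_upto w i) \<Longrightarrow> end1 e \<noteq> Root \<and> end2 e \<noteq> Root"
proof (induction i)
  case (Suc i)
  have "inv (word_perm u) x \<noteq> Root" if "x \<noteq> Root" for u x
    using that by (metis bij_word_perm bij_inv_eq_iff word_perm_Root)
  moreover have "fst (pivots v) \<noteq> Root" "snd (pivots v) \<noteq> Root" for v
    by (cases v; simp)+
  ultimately show ?case
    using Suc by (auto simp: Let_def)
qed simp

lemma Sigma_tree:
  defines "S \<equiv> \<lambda>w. \<Union>e\<in>set (Sigma_edges w). {end1 e, end2 e}"
  shows "binary_tree (Sigma_tree w)" "S w \<subseteq> internal (Sigma_tree w)"
    "\<And>T. binary_tree T \<Longrightarrow> S w \<subseteq> internal T \<Longrightarrow> Sigma_tree w \<subseteq> T"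
proof -
  have "finite (S w)" "Root \<notin> S w"
    using Root_notin_Sigma_upto[of _ w] by (auto simp: S_def Sigma_edges_def) metis+
  from smallest_tree[OF this]
  show "binary_tree (Sigma_tree w)" "S w \<subseteq> internal (Sigma_tree w)"
    "\<And>T. binary_tree T \<Longrightarrow> S w \<subseteq> internal T \<Longrightarrow> Sigma_tree w \<subseteq> T"
    by (auto simp: Sigma_tree_def S_def)
qed

end

theory Submission
  imports Defs
begin

text \<open>
  Colour the internal vertices of \<open>T\<close> by the components of the graph, and let a rotation carry
  the colour of a vertex along to its image. Every rotation of the path then has two pivots of the
  same colour. Suppose that there are two colours. As the internal vertices of a tree hang
  together, some internal vertex \<open>a\<close> of \<open>T\<close> has a parent of another colour. In the dual
  triangulation, the diagonal of \<open>a\<close> lies between two triangles of different colours. A rotation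
  flips a diagonal between triangles of equal colours, so it leaves this one in place; the flip may
  replace a triangle on one side of it, but only by a triangle of the same colour. Hence the
  diagonal survives every rotation with different colours on its two sides
  (\<open>bichromatic_diagonal_survives_rotation\<close>), and \<open>T\<close> and its image under the path have it in
  common (\<open>bichromatic_diagonal_survives_path\<close>), so they are not a prime pair.

  The path may be followed from \<open>T\<close> because the ends of the edges of the graph are internal
  vertices of \<open>T\<close> and a rotation that applies to a tree maps internal vertices to internal
  vertices (\<open>internal_rotated\<close>): they are the pivots, pulled back to \<open>T\<close>.
\<close>

section \<open>Rotations in both directions\<close>

text \<open>The two kinds of rotation are mirror images. The bit \<open>c\<close> says on which side of the upper
  pivot the lower one lies, so that a single argument serves both.\<close>

definition rot_word :: "bool \<Rightarrow> word \<Rightarrow> word" where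
  "rot_word c = (if c then unrot_suffix else rot_suffix)"

definition rot_word_at :: "bool \<Rightarrow> word \<Rightarrow> word \<Rightarrow> word" where
  "rot_word_at c u v = (if prefix u v then u @ rot_word c (drop (length u) v) else v)"

lemma rot_word_simps [simp]:
  "rot_word c (c # c # w) = c # w"
  "rot_word c (c # (\<not> c) # w) = (\<not> c) # c # w"
  "rot_word c ((\<not> c) # w) = (\<not> c) # (\<not> c) # w"
  "rot_word c [c] = []"
  "rot_word c [] = [\<not> c]"
  by (cases c; simp add: rot_word_def)+

lemma rot_word_inverse [simp]: "rot_word (\<not> c) (rot_word c w) = w"
  by (cases c) (auto simp: rot_word_def unrot_rot_suffix rot_unrot_suffix)

lemma rot_word_at_append [simp]: "rot_word_at c u (u @ s) = u @ rot_word c s"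
  by (simp add: rot_word_at_def)

lemma rot_word_at_pivot [simp]: "rot_word_at c u u = u @ [\<not> c]"
  using rot_word_at_append[of c u "[]"] by simp

lemma rot_word_at_other [simp]: "\<not> prefix u v \<Longrightarrow> rot_word_at c u v = v"
  by (simp add: rot_word_at_def)

lemma rot_word_at_inverse [simp]: "rot_word_at (\<not> c) u (rot_word_at c u v) = v"
  by (cases "prefix u v") (auto simp: prefix_def)

lemma rot_word_at_inverse' [simp]: "rot_word_at c u (rot_word_at (\<not> c) u v) = v"
  using rot_word_at_inverse[of "\<not> c"] by simp

lemma rot_word_cases:
  obtains "s = []" | "s = [c]" | w where "s = c # c # w" | w where "s = c # (\<not> c) # w"
  | w where "s = (\<not> c) # w"
proof (cases s)
  case (Cons a r)
  then show ?thesis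
    using that by (cases "a = c"; cases r) auto
qed (use that in auto)

text \<open>Below the upper pivot, the two pivots are the only vertices whose children are not sent to
  the children of their images.\<close>

lemma rot_word_snoc:
  assumes "s \<noteq> []" "s \<noteq> [c]"
  shows "rot_word c (s @ [b]) = rot_word c s @ [b]"
  using assms by (cases rule: rot_word_cases[where s = s and c = c]) auto

lemma rotation_as_rot_word:
  obtains c u where "pivots v = (Word u, Word (u @ [c]))"
    "rotation v Root = Root" "\<And>x. rotation v (Word x) = Word (rot_word_at c u x)"
    "\<And>x. inv (rotation v) (Word x) = Word (rot_word_at (\<not> c) u x)"
proof (cases v)
  case (Pos u)
  then show ?thesis
    by (intro that[of u False]) (auto simp: inv_rotate_at rot_word_at_def rot_word_def)
next
  case (Neg u)
  have "inv (unrotate_at u) = rotate_at u"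
    by (metis inv_rotate_at inv_inv_eq bij_rotate_at)
  then show ?thesis
    using Neg by (intro that[of u True]) (auto simp: inv_rotate_at rot_word_at_def rot_word_def)
qed

section \<open>Rotations of trees\<close>

lemma binary_tree_ancestor:
  "binary_tree T \<Longrightarrow> Word v \<in> T \<Longrightarrow> prefix u v \<Longrightarrow> Word u \<in> T"
  unfolding binary_tree_def by blast

lemma binary_tree_sibling: "binary_tree T \<Longrightarrow> Word (v @ [b]) \<in> T \<Longrightarrow> Word (v @ [b']) \<in> T"
  unfolding binary_tree_def by (cases b; cases b') auto

lemma internal_iff_child:
  assumes "binary_tree T"
  shows "Word v \<in> internal T \<longleftrightarrow> Word (v @ [b]) \<in> T"
proof -
  have "Word v \<in> T" if "Word (v @ [b]) \<in> T"
    using binary_tree_ancestor[OF assms that] by simp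
  moreover have "Word (v @ [b']) \<in> T \<longleftrightarrow> Word (v @ [b]) \<in> T" for b'
    using binary_tree_sibling[OF assms] by blast
  ultimately show ?thesis
    by (auto simp: internal_def leaves_def)
qed

lemma binary_treeI:
  assumes "finite T" "Root \<in> T" "Word [] \<in> T"
    and parent: "\<And>v b. Word (v @ [b]) \<in> T \<Longrightarrow> Word v \<in> T"
    and "\<And>u. Word (u @ [False]) \<in> T \<longleftrightarrow> Word (u @ [True]) \<in> T"
  shows "binary_tree T"
proof -
  have "Word u \<in> T" if "Word (u @ s) \<in> T" for u s
    using that
  proof (induction s rule: rev_induct)
    case (snoc b s)
    then show ?case using parent[of "u @ s" b] by simp
  qed simp
  then have "\<forall>u v. Word v \<in> T \<longrightarrow> prefix u v \<longrightarrow> Word u \<in> T"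
    by (metis prefixE)
  then show ?thesis
    using assms(1-3,5) unfolding binary_tree_def by blast
qed

lemma Root_notin_leaves: "binary_tree T \<Longrightarrow> Root \<notin> leaves T"
  by (simp add: binary_tree_def leaves_def)

lemma leaves_eq: "binary_tree T \<Longrightarrow> leaves T = T - {Root} - internal T"
  using Root_notin_leaves by (auto simp: internal_def leaves_def)

context
  fixes T T' :: "vertex set" and v :: rot_symbol and u :: word and c :: bool
  assumes tree: "binary_tree T"
    and piv: "pivots v = (Word u, Word (u @ [c]))"
    and rotR: "rotation v Root = Root"
    and rotW: "\<And>x. rotation v (Word x) = Word (rot_word_at c u x)"
    and upper: "Word u \<in> internal T"
    and lower: "Word (u @ [c]) \<in> internal T"
    and T': "T' = rotation v ` T"
begin

lemma Word_in_image: "Word x \<in> rotation v ` A \<longleftrightarrow> Word (rot_word_at (\<not> c) u x) \<in> A"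
proof
  assume "Word x \<in> rotation v ` A"
  then obtain y where "y \<in> A" "Word x = rotation v y" by auto
  then show "Word (rot_word_at (\<not> c) u x) \<in> A"
    by (cases y) (auto simp: rotR rotW)
next
  assume "Word (rot_word_at (\<not> c) u x) \<in> A"
  then have "rotation v (Word (rot_word_at (\<not> c) u x)) \<in> rotation v ` A" by blast
  then show "Word x \<in> rotation v ` A" by (simp add: rotW)
qed

text \<open>Although a rotation does not send the children of a vertex to the children of its image,
  the vertices for which this fails have all their children in the tree, before and after the
  rotation.\<close>

lemma child_in_rotated:
  "Word (x @ [b]) \<in> T' \<longleftrightarrow> Word (rot_word_at (\<not> c) u x) \<in> internal T"
proof (cases "prefix u x")
  case False
  show ?thesis
  proof (cases "prefix u (x @ [b])")
    case True
    then have u: "u = x @ [b]" using False by simp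
    have "Word (u @ [c]) \<in> T" "Word u \<in> T"
      using upper lower by (auto simp: internal_def)
    then have "Word x \<in> internal T" and "Word (rot_word_at (\<not> c) u u) \<in> T"
      using internal_iff_child[OF tree] u by auto
    then show ?thesis
      using False u by (simp add: T' Word_in_image)
  next
    case no: False
    then show ?thesis
      using False internal_iff_child[OF tree] by (simp add: T' Word_in_image)
  qed
next
  case True
  then obtain s where x: "x = u @ s" by (auto simp: prefix_def)
  have in_T: "Word u \<in> T" "Word (u @ [b']) \<in> T" "Word (u @ [c, b']) \<in> T" for b'
    using upper lower internal_iff_child[OF tree, of u b']
      internal_iff_child[OF tree, of "u @ [c]" b'] by (auto simp: internal_def)
  consider "s = []" | "s = [\<not> c]" | "s \<noteq> []" "s \<noteq> [\<not> c]" by blast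
  then show ?thesis
  proof cases
    case 1
    then show ?thesis
      using in_T lower rot_word_simps(3)[of "\<not> c" "[]"] rot_word_simps(4)[of "\<not> c"]
      by (cases "b = c") (auto simp: x T' Word_in_image)
  next
    case 2
    then show ?thesis
      using in_T upper rot_word_simps(1)[of "\<not> c" "[]"] rot_word_simps(2)[of "\<not> c" "[]"]
        rot_word_simps(4)[of "\<not> c"]
      by (cases "b = c") (auto simp: x T' Word_in_image)
  next
    case 3
    then show ?thesis
      using internal_iff_child[OF tree, of "u @ rot_word (\<not> c) s" b] rot_word_snoc[of s "\<not> c" b]
      by (simp add: x T' Word_in_image)
  qed
qed

lemma binary_tree_rotated: "binary_tree T'"
proof (rule binary_treeI)
  show "finite T'" "Root \<in> T'"
    using tree rotR by (auto simp: T' binary_tree_def intro: rev_image_eqI)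
  show "Word [] \<in> T'"
    using tree lower by (cases "u = []") (auto simp: T' Word_in_image binary_tree_def internal_def)
  show "Word x \<in> T'" if "Word (x @ [b]) \<in> T'" for x b
    using that unfolding child_in_rotated by (auto simp: T' Word_in_image internal_def)
qed (simp add: child_in_rotated)

lemma internal_rotated: "internal T' = rotation v ` internal T"
proof (rule set_eqI)
  fix y show "y \<in> internal T' \<longleftrightarrow> y \<in> rotation v ` internal T"
  proof (cases y)
    case Root
    have "Root \<notin> rotation v ` internal T"
    proof
      assume "Root \<in> rotation v ` internal T"
      then obtain x where "x \<in> internal T" "Root = rotation v x" by auto
      then show False by (cases x) (auto simp: internal_def rotW)
    qed
    then show ?thesis using Root by (simp add: internal_def)
  next
    case (Word x)
    then show ?thesis
      by (simp add: internal_iff_child[OF binary_tree_rotated, of _ False] child_in_rotated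
          Word_in_image)
  qed
qed

lemma leaf_rotated: "Word x \<in> leaves T' \<longleftrightarrow> Word (rot_word_at (\<not> c) u x) \<in> leaves T"
  unfolding leaves_eq[OF tree] leaves_eq[OF binary_tree_rotated] internal_rotated
  by (simp add: T' Word_in_image)

end

section \<open>Diagonals under rotations\<close>

lemma left_of_simps [simp]:
  "\<not> left_of [] b" "\<not> left_of a []"
  "left_of (x # a) (y # b) \<longleftrightarrow> \<not> x \<and> y \<or> x = y \<and> left_of a b"
proof -
  show "left_of (x # a) (y # b) \<longleftrightarrow> \<not> x \<and> y \<or> x = y \<and> left_of a b"
  proof
    assume "left_of (x # a) (y # b)"
    then obtain p where "prefix (p @ [False]) (x # a)" "prefix (p @ [True]) (y # b)"
      by (auto simp: left_of_def)
    then show "\<not> x \<and> y \<or> x = y \<and> left_of a b"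
      by (cases p) (auto simp: left_of_def)
  next
    assume r: "\<not> x \<and> y \<or> x = y \<and> left_of a b"
    then consider "\<not> x" "y" | p where "x = y" "prefix (p @ [False]) a" "prefix (p @ [True]) b"
      by (auto simp: left_of_def)
    then show "left_of (x # a) (y # b)"
    proof cases
      case 1
      then show ?thesis unfolding left_of_def by (intro exI[of _ "[]"]) auto
    next
      case (2 p)
      then show ?thesis unfolding left_of_def by (intro exI[of _ "x # p"]) auto
    qed
  qed
qed (auto simp: left_of_def)

lemma left_of_same_prefix [simp]: "left_of (u @ a) (u @ b) \<longleftrightarrow> left_of a b"
  by (induction u) auto

lemma left_of_prefix [simp]: "\<not> left_of (u @ a) u"
  by (induction u) auto

lemma left_of_append_right:
  "\<not> prefix u b \<Longrightarrow> left_of b (u @ s) \<longleftrightarrow> left_of b u"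
proof (induction u arbitrary: b)
  case (Cons x u)
  then show ?case by (cases b) auto
qed simp

lemma left_of_append_left:
  "\<not> prefix u a \<Longrightarrow> left_of (u @ s) a \<longleftrightarrow> left_of u a"
proof (induction u arbitrary: a)
  case (Cons x u)
  then show ?case by (cases a) auto
qed simp

text \<open>A rotation flips the diagonal of the lower pivot \<open>u @ [c]\<close> and keeps all others. Its
  action on the vertices carries a diagonal to itself, except for the diagonal of the upper pivot
  \<open>u\<close>: this one still belongs to the position \<open>u\<close> afterwards, while the vertex moves away.\<close>

definition new_position :: "bool \<Rightarrow> word \<Rightarrow> word \<Rightarrow> word" where
  "new_position c u x = (if x = u then u else rot_word_at c u x)"

lemma rot_word_below_iff:
  assumes "s \<noteq> []" "s \<noteq> [c]" "r \<noteq> []" "r \<noteq> [c]"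
  shows "prefix (rot_word c s) (rot_word c r) \<longleftrightarrow> prefix s r"
  using assms
  by (cases rule: rot_word_cases[where s = s and c = c]; cases rule: rot_word_cases[where s = r and c = c]) auto

lemma rot_word_left_of_iff:
  assumes "s \<noteq> []" "s \<noteq> [c]" "r \<noteq> []" "r \<noteq> [c]"
  shows "left_of (rot_word c r) (rot_word c s) \<longleftrightarrow> left_of r s"
  using assms
  by (cases rule: rot_word_cases[where s = s and c = c]; cases rule: rot_word_cases[where s = r and c = c]) auto

lemma new_position_below_and_left_of:
  assumes "x \<noteq> u @ [c]" "y \<noteq> u" "y \<noteq> u @ [c]"
  shows "prefix (new_position c u x) (rot_word_at c u y) \<longleftrightarrow> prefix x y"
    and "left_of (rot_word_at c u y) (new_position c u x) \<longleftrightarrow> left_of y x"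
proof -
  have "(prefix (new_position c u x) (rot_word_at c u y) \<longleftrightarrow> prefix x y)
    \<and> (left_of (rot_word_at c u y) (new_position c u x) \<longleftrightarrow> left_of y x)"
  proof (cases "prefix u y")
    case True
    then obtain r where y: "y = u @ r" "r \<noteq> []" "r \<noteq> [c]"
      using assms by (auto simp: prefix_def)
    consider "x = u" | s where "x = u @ s" "s \<noteq> []" "s \<noteq> [c]" | "\<not> prefix u x"
      using assms by (auto simp: prefix_def)
    then show ?thesis
    proof cases
      case 1
      then show ?thesis using y by (simp add: new_position_def)
    next
      case 2
      then show ?thesis
        using y by (simp add: new_position_def rot_word_below_iff rot_word_left_of_iff)
    next
      case 3
      have "prefix x (u @ q) \<longleftrightarrow> prefix x u" for q
        using 3 by (auto simp: prefix_append)
      then show ?thesis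
        using 3 y by (auto simp: new_position_def left_of_append_left)
    qed
  next
    case False
    have "\<not> prefix (u @ q) y" for q
      using False append_prefixD by blast
    then show ?thesis
      using False left_of_append_right[OF False]
      by (cases "prefix u x") (auto simp: new_position_def prefix_def)
  qed
  then show "prefix (new_position c u x) (rot_word_at c u y) \<longleftrightarrow> prefix x y"
    and "left_of (rot_word_at c u y) (new_position c u x) \<longleftrightarrow> left_of y x"
    by blast+
qed

text \<open>The pivots are not leaves, so a rotation matches the leaves below (or to the left of) a
  vertex with those below (or to the left of) its new position. This is how the numbering of the
  leaves stays the same although their words change.\<close>

lemma chord_new_position:
  assumes T: "binary_tree T" and v: "pivots v = (Word u, Word (u @ [c]))"
    "rotation v Root = Root" "\<And>x. rotation v (Word x) = Word (rot_word_at c u x)"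
    and int: "Word u \<in> internal T" "Word (u @ [c]) \<in> internal T"
    and x: "x \<noteq> u @ [c]"
  shows "chord (rotation v ` T) (new_position c u x) = chord T x"
proof -
  let ?T' = "rotation v ` T"
  have card_eq: "card {b. Word b \<in> leaves ?T' \<and> P' b} = card {b. Word b \<in> leaves T \<and> P b}"
    if P: "\<And>b. b \<noteq> u \<Longrightarrow> b \<noteq> u @ [c] \<Longrightarrow> P' (rot_word_at c u b) \<longleftrightarrow> P b" for P P'
  proof -
    have leaf: "b \<noteq> u" "b \<noteq> u @ [c]" if "Word b \<in> leaves T" for b
      using that int by (auto simp: internal_def)
    have "{b. Word b \<in> leaves ?T' \<and> P' b} = rot_word_at c u ` {b. Word b \<in> leaves T \<and> P b}"
    proof (intro set_eqI iffI)
      fix b assume "b \<in> {b. Word b \<in> leaves ?T' \<and> P' b}"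
      then have b: "Word (rot_word_at (\<not> c) u b) \<in> leaves T" "P' b"
        by (auto simp: leaf_rotated[OF T v int refl])
      then have "P (rot_word_at (\<not> c) u b)"
        using P[OF leaf[OF b(1)]] by simp
      then show "b \<in> rot_word_at c u ` {b. Word b \<in> leaves T \<and> P b}"
        using b by (intro rev_image_eqI[of "rot_word_at (\<not> c) u b"]) auto
    next
      fix b assume "b \<in> rot_word_at c u ` {b. Word b \<in> leaves T \<and> P b}"
      then show "b \<in> {b. Word b \<in> leaves ?T' \<and> P' b}"
        using P leaf by (auto simp: leaf_rotated[OF T v int refl])
    qed
    moreover have "inj (rot_word_at c u)"
      by (metis injI rot_word_at_inverse)
    ultimately show ?thesis
      by (simp add: card_image inj_on_subset)
  qed
  show ?thesis
    unfolding chord_def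
    using card_eq[of "\<lambda>b. left_of b (new_position c u x)" "\<lambda>b. left_of b x"]
      card_eq[of "prefix (new_position c u x)" "prefix x"]
      new_position_below_and_left_of[OF x]
    by simp
qed

section \<open>Diagonals between different colours\<close>

definition bichromatic :: "(vertex \<Rightarrow> 'c) \<Rightarrow> vertex set \<Rightarrow> word \<Rightarrow> bool" where
  "bichromatic col T x \<longleftrightarrow>
     x \<noteq> [] \<and> Word x \<in> internal T \<and> col (Word x) \<noteq> col (Word (butlast x))"

text \<open>The diagonal of \<open>x\<close> is kept because the lower pivot, whose diagonal is flipped, has a
  parent of its own colour. The vertices on the two sides of the diagonal of \<open>x\<close> are carried
  along, except that one pivot may take the place of the other; this does not change the
  colours.\<close>

lemma bichromatic_diagonal_survives_rotation:
  assumes T: "binary_tree T"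
    and piv: "fst (pivots v) \<in> internal T" "snd (pivots v) \<in> internal T"
    and mono: "col (fst (pivots v)) = col (snd (pivots v))"
    and x: "bichromatic col T x"
  shows "\<exists>x'. bichromatic (col \<circ> inv (rotation v)) (rotation v ` T) x'
    \<and> chord (rotation v ` T) x' = chord T x"
proof -
  obtain c u where v: "pivots v = (Word u, Word (u @ [c]))"
    "rotation v Root = Root" "\<And>x. rotation v (Word x) = Word (rot_word_at c u x)"
    and inv: "\<And>x. inv (rotation v) (Word x) = Word (rot_word_at (\<not> c) u x)"
    by (rule rotation_as_rot_word[of v]) (rule that)
  have int: "Word u \<in> internal T" "Word (u @ [c]) \<in> internal T"
    and col: "col (Word (u @ [c])) = col (Word u)"
    using piv mono v by auto
  have x0: "x \<noteq> []" "Word x \<in> internal T" and colx: "col (Word x) \<noteq> col (Word (butlast x))"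
    using x by (auto simp: bichromatic_def)
  have xl: "x \<noteq> u @ [c]"
    using colx col by auto
  let ?col = "\<lambda>y. col (Word (rot_word_at (\<not> c) u y))"
  have col_u: "?col u = col (Word u)" "?col (u @ [\<not> c]) = col (Word u)"
    using rot_word_simps(4)[of "\<not> c"] by (simp_all add: col)
  define x' where "x' = new_position c u x"
  have "x' \<noteq> [] \<and> Word (rot_word_at (\<not> c) u x') \<in> internal T
    \<and> ?col x' = col (Word x) \<and> ?col (butlast x') = col (Word (butlast x))"
  proof -
    consider "\<not> prefix u x" | "x = u" | s where "x = u @ s" "s \<noteq> []" "s \<noteq> [c]"
      using xl by (auto simp: prefix_def)
    then show ?thesis
    proof cases
      case 1
      then have "\<not> prefix u (butlast x)"
        using prefix_order.trans[OF _ prefixeq_butlast] by blast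
      moreover have "x' = x"
        using 1 by (auto simp: x'_def new_position_def)
      ultimately show ?thesis using 1 x0 by simp
    next
      case 2
      have "\<not> prefix u (butlast u)"
        using x0 2 prefix_length_le[of u "butlast u"] by (cases u) auto
      then show ?thesis
        using 2 x0 int col by (simp add: x'_def new_position_def)
    next
      case (3 s)
      have x': "x' = u @ rot_word c s"
        using 3 by (simp add: x'_def new_position_def)
      have ne: "rot_word c s \<noteq> []"
        by (cases rule: rot_word_cases[where s = s and c = c]) (use 3 in auto)
      have "?col (u @ butlast (rot_word c s)) = col (Word (u @ butlast s))"
      proof -
        obtain r b where s: "s = r @ [b]"
          using 3 by (cases s rule: rev_cases) auto
        (* The new parent is the image of the old one, except for the inner child of the lower
           pivot, whose new parent is the image of the upper pivot. *)
        consider "r = []" "b = (\<not> c)" | "r = [c]" "b = c" | "r = [c]" "b = (\<not> c)"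
          | "r \<noteq> []" "r \<noteq> [c]"
          using s 3 by auto
        then show ?thesis
        proof cases
          case 1
          then show ?thesis using col_u s by simp
        next
          case 2
          then show ?thesis using col_u col s by simp
        next
          case 3
          then show ?thesis using col_u col s by simp
        next
          case 4
          then show ?thesis using s by (simp add: rot_word_snoc)
        qed
      qed
      then show ?thesis
        using x' ne 3 x0 by (simp add: butlast_append)
    qed
  qed
  then have "bichromatic (col \<circ> inv (rotation v)) (rotation v ` T) x'"
    using colx unfolding bichromatic_def internal_rotated[OF T v int refl]
    by (simp add: inv Word_in_image[OF T v int refl])
  then show ?thesis
    using chord_new_position[OF T v int xl] x'_def by blast
qed

text \<open>Vertices on the way are named by the vertices of \<open>T\<close> that they come from. In the induction,
  passing to the rotated tree therefore replaces \<open>col\<close> by its composition with the inverse of the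
  first rotation.\<close>

lemma bichromatic_diagonal_survives_path:
  assumes "binary_tree T"
    and "\<And>i. i < length w \<Longrightarrow>
      inv (word_perm (take i w)) (fst (pivots (w ! i))) \<in> internal T
      \<and> inv (word_perm (take i w)) (snd (pivots (w ! i))) \<in> internal T
      \<and> col (inv (word_perm (take i w)) (fst (pivots (w ! i))))
        = col (inv (word_perm (take i w)) (snd (pivots (w ! i))))"
    and "bichromatic col T x"
  shows "\<exists>x'. x' \<noteq> [] \<and> Word x' \<in> internal (act T w) \<and> chord (act T w) x' = chord T x"
  using assms
proof (induction w arbitrary: T col x)
  case Nil
  then show ?case by (auto simp: act_def bichromatic_def)
next
  case (Cons v w)
  let ?T' = "rotation v ` T" and ?col = "col \<circ> inv (rotation v)"
  have first: "fst (pivots v) \<in> internal T" "snd (pivots v) \<in> internal T"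
    "col (fst (pivots v)) = col (snd (pivots v))"
    using Cons.prems(2)[of 0] by auto
  obtain c u where v: "pivots v = (Word u, Word (u @ [c]))"
    "rotation v Root = Root" "\<And>x. rotation v (Word x) = Word (rot_word_at c u x)"
    by (rule rotation_as_rot_word[of v]) (rule that)
  have int: "Word u \<in> internal T" "Word (u @ [c]) \<in> internal T"
    using first v by auto
  obtain x' where x': "bichromatic ?col ?T' x'" "chord ?T' x' = chord T x"
    using bichromatic_diagonal_survives_rotation[OF Cons.prems(1) first Cons.prems(3)] by blast
  have "inv (word_perm (take i w)) y \<in> internal ?T'"
    if "inv (word_perm (take (Suc i) (v # w))) y \<in> internal T" for i y
  proof -
    have "inv (rotation v) (inv (word_perm (take i w)) y) \<in> internal T"
      using that by (simp add: o_inv_distrib bij_word_perm bij_rotation)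
    then have "rotation v (inv (rotation v) (inv (word_perm (take i w)) y)) \<in> internal ?T'"
      unfolding internal_rotated[OF Cons.prems(1) v int refl] by (rule imageI)
    then show ?thesis
      using bij_rotation[of v] by (simp add: bij_is_surj surj_f_inv_f)
  qed
  moreover have "?col (inv (word_perm (take i w)) y) = col (inv (word_perm (take (Suc i) (v # w))) y)"
    for i y
    by (simp add: o_inv_distrib bij_word_perm bij_rotation)
  ultimately have "\<exists>x''. x'' \<noteq> [] \<and> Word x'' \<in> internal (act ?T' w)
      \<and> chord (act ?T' w) x'' = chord ?T' x'"
    using Cons.prems(2)[of "Suc _"]
    by (intro Cons.IH[OF binary_tree_rotated[OF Cons.prems(1) v int refl] _ x'(1)])
      (metis Suc_less_eq length_Cons nth_Cons_Suc)
  moreover have "act ?T' w = act T (v # w)"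
    by (simp add: act_def image_comp)
  ultimately show ?case
    using x'(2) by simp
qed

lemma two_colours_imp_bichromatic:
  assumes T: "binary_tree T" and "y \<in> internal T" "z \<in> internal T" "col y \<noteq> col z"
  shows "\<exists>x. bichromatic col T x"
proof (rule ccontr)
  assume no: "\<nexists>x. bichromatic col T x"
  have "col (Word x) = col (Word [])" if "Word x \<in> internal T" for x
    using that
  proof (induction x rule: rev_induct)
    case (snoc b x)
    have "Word x \<in> internal T"
      using snoc.prems internal_iff_child[OF T, of x b] by (simp add: internal_def)
    then show ?case
      using snoc no by (auto simp: bichromatic_def)
  qed simp
  then have "col y = col (Word [])" if "y \<in> internal T" for y
    using that by (cases y) (auto simp: internal_def)
  then show False
    using assms by metis
qed

section \<open>Components of the graph of a path\<close>

lemma length_Sigma_upto [simp]: "length (Sigma_upto w i) = i"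
  by (induction i) (auto simp: Let_def)

lemma ends_Sigma_upto:
  "j < i \<Longrightarrow> end1 (Sigma_upto w i ! j) = inv (word_perm (take j w)) (fst (pivots (w ! j)))
    \<and> end2 (Sigma_upto w i ! j) = inv (word_perm (take j w)) (snd (pivots (w ! j)))"
  by (induction i) (auto simp: Let_def nth_append less_Suc_eq)

theorem theorem11p5:
  fixes d :: nat and D T :: "vertex set" and w :: "rot_symbol list"
  assumes "edge_path d D w"
    and "T = Sigma_tree w"
    and "prime_pair T (act T w)"
  shows "connected (Sigma_graph w)"
proof (rule ccontr)
  assume disconnected: "\<not> connected (Sigma_graph w)"
  let ?G = "Sigma_graph w"
  define s where "s = (\<lambda>i. inv (word_perm (take i w)) (fst (pivots (w ! i))))"
  define t where "t = (\<lambda>i. inv (word_perm (take i w)) (snd (pivots (w ! i))))"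
  have T: "binary_tree T"
    using assms(2) Sigma_tree(1) by simp
  have ends: "end1 (Sigma_edges w ! i) = s i" "end2 (Sigma_edges w ! i) = t i"
    if "i < length w" for i
    using that ends_Sigma_upto by (auto simp: Sigma_edges_def s_def t_def)
  have len: "length (Sigma_edges w) = length w"
    by (simp add: Sigma_edges_def)
  have int: "s i \<in> internal T" "t i \<in> internal T" if "i < length w" for i
  proof -
    have "Sigma_edges w ! i \<in> set (Sigma_edges w)"
      using that len by simp
    then have "{s i, t i} \<subseteq> internal T"
      using Sigma_tree(2)[of w] ends[OF that] assms(2) by (auto simp: UN_subset_iff)
    then show "s i \<in> internal T" "t i \<in> internal T" by auto
  qed
  interpret G: wf_digraph ?G
    by unfold_locales (use int ends len assms(2) in \<open>auto simp: Sigma_graph_def\<close>)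
  interpret S: pair_wf_digraph "mk_symmetric ?G"
    by (rule G.wellformed_mk_symmetric)
  define col where "col = (\<lambda>x. {y. x \<rightarrow>\<^sup>*\<^bsub>mk_symmetric ?G\<^esub> y})"
  have mono: "col (s i) = col (t i)" if i: "i < length w" for i
  proof -
    have "s i \<rightarrow>\<^bsub>?G\<^esub> t i"
      using i ends len by (force simp: arcs_ends_def arc_to_ends_def Sigma_graph_def)
    then have "s i \<rightarrow>\<^sup>*\<^bsub>mk_symmetric ?G\<^esub> t i"
      by (meson G.reachable_mk_symmetricI G.reachable_adjI)
    moreover from this have "t i \<rightarrow>\<^sup>*\<^bsub>mk_symmetric ?G\<^esub> s i"
      by (rule symmetric_reachable[OF symmetric_mk_symmetric])
    ultimately show ?thesis
      unfolding col_def
      by (blast intro: S.reachable_trans)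
  qed
  have "2 \<le> card (leaves T)"
    using assms(3) by (simp add: prime_pair_def)
  (* The only tree without internal vertices has a single leaf. *)
  have nonempty: "internal T \<noteq> {}"
  proof
    assume "internal T = {}"
    then have "Word x \<notin> T" if "x \<noteq> []" for x
      using that internal_iff_child[OF T] by (cases x rule: rev_cases) auto
    have "y = Word []" if "y \<in> leaves T" for y
      using that \<open>\<And>x. x \<noteq> [] \<Longrightarrow> Word x \<notin> T\<close> Root_notin_leaves[OF T]
      by (cases y) (auto simp: leaves_def)
    then have "leaves T \<subseteq> {Word []}" by blast
    then show False
      using \<open>2 \<le> card (leaves T)\<close> card_mono[of "{Word []}" "leaves T"] by simp
  qed
  have "\<exists>y\<in>internal T. \<exists>z\<in>internal T. \<not> y \<rightarrow>\<^sup>*\<^bsub>mk_symmetric ?G\<^esub> z"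
    using disconnected nonempty assms(2)
    by (auto simp: connected_def strongly_connected_def Sigma_graph_def)
  then obtain y z where yz: "y \<in> internal T" "z \<in> internal T" "\<not> y \<rightarrow>\<^sup>*\<^bsub>mk_symmetric ?G\<^esub> z"
    by blast
  have "z \<rightarrow>\<^sup>*\<^bsub>mk_symmetric ?G\<^esub> z"
    using yz(2) assms(2) by (intro S.reachable_refl) (simp add: Sigma_graph_def)
  then have "col y \<noteq> col z"
    using yz(3) by (auto simp: col_def)
  then obtain x where x: "bichromatic col T x"
    using two_colours_imp_bichromatic[OF T yz(1,2)] by blast
  have "\<exists>x'. x' \<noteq> [] \<and> Word x' \<in> internal (act T w) \<and> chord (act T w) x' = chord T x"
    using int mono unfolding s_def t_def
    by (intro bichromatic_diagonal_survives_path[OF T _ x]) blast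
  then obtain x' where x': "x' \<noteq> []" "Word x' \<in> internal (act T w)"
    "chord (act T w) x' = chord T x"
    by blast
  have "Diagonal1 x \<in> glued_edges T (act T w)" "Diagonal2 x' \<in> glued_edges T (act T w)"
    using x x' by (auto simp: glued_edges_def bichromatic_def)
  moreover have "glued_ends T (act T w) (Diagonal1 x) = glued_ends T (act T w) (Diagonal2 x')"
    using x' by simp
  ultimately have "Diagonal1 x = Diagonal2 x'"
    using assms(3) unfolding prime_pair_def by (metis inj_onD)
  then show False by simp
qed

end
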